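(* Let $V$ be a $U^{\vee}_q$-module which is an $\mathbb{F}$-vector space of finite positive dimension. Let $V_{inv}$ (resp. $V_{nil}$) denote the invertible part (resp. nilpotent part) of $V$ with respect to $y^{-1}$. Then $$V = V_{inv} + V_{nil}\qquad\text{(direct sum of $U^\vee_q$-modules)}.$$ If $V_{inv}$ is nonzero, then on $V_{inv}$ the action of $U^\vee_q$ extends to an action of $U_q(\mathfrak{sl}_2)$. If $V_{nil}$ is nonzero, then on $V_{nil}$ the action of $U^\vee_q$ does not extend to an action of $U_q(\mathfrak{sl}_2)$.
   Context: $\mathbb{F}$ is a field and $q\in\mathbb{F}$ is nonzero with $q^4\neq 1$. $U_q(\mathfrak{sl}_2)$ is the (associative unital) $\mathbb{F}$-algebra with generators $x,y^{\pm1},z$ and relations $yy^{-1}=y^{-1}y=1$, $$\frac{qxy-q^{-1}yx}{q-q^{-1}} = 1,\qquad \frac{qyz-q^{-1}zy}{q-q^{-1}} = 1,\qquad \frac{qzx-q^{-1}xz}{q-q^{-1}} = 1.$$ $U^\vee_q$ is the (unital) subalgebra of $U_q(\mathfrak{sl}_2)$ generated by $x,y^{-1},z$. For a linear map $T:V\to V$ on a finite-dimensional vector space, the invertible part of $V$ with respect to $T$ is $V_{inv}=\bigcap_{n\ge0}T^n(V)$ and the nilpotent part is $V_{nil}=\bigcup_{n\ge0}\ker(T^n)$. Here $T$ is the action of $y^{-1}\in U^\vee_q$ on $V$. *)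

theory Defs
  imports "HOL-Library.Poly_Mapping" "HOL-Algebra.QuotRing" "HOL-Algebra.Generated_Rings"
begin

text \<open>The free monoid on a type of letters. Finitely supported functions from it to a field,
  with the convolution product of \<^theory>\<open>HOL-Library.Poly_Mapping\<close>, form the free associative
  unital algebra.\<close>

datatype 'g free_word = Word (letters: "'g list")

instantiation free_word :: (type) monoid_add
begin

definition "0 = Word []"
definition "u + v = Word (letters u @ letters v)"

instance
  by standard (simp_all add: zero_free_word_def plus_free_word_def)

end

type_synonym ('a, 'g) free_alg = "'g free_word \<Rightarrow>\<^sub>0 'a"

definition const :: "'a::field \<Rightarrow> ('a, 'g) free_alg" where
  "const c = Poly_Mapping.single 0 c"

definition gen :: "'g \<Rightarrow> ('a::field, 'g) free_alg" where
  "gen g = Poly_Mapping.single (Word [g]) 1"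

definition free_ring :: "('a::field, 'g) free_alg ring" where
  "free_ring = \<lparr>carrier = UNIV, mult = (*), one = 1, zero = 0, add = (+)\<rparr>"


datatype uq_gen = gx | gy | gyinv | gz

text \<open>Each relation $l = r$ is recorded as the element $l - r$. The library's notion of
  \<^const>\<open>ideal\<close>, hence also \<^const>\<open>genideal\<close>, is two-sided.\<close>

definition qrel :: "'a::field \<Rightarrow> uq_gen \<Rightarrow> uq_gen \<Rightarrow> ('a, uq_gen) free_alg" where
  "qrel q a b =
     const (inverse (q - inverse q)) *
       (const q * gen a * gen b - const (inverse q) * gen b * gen a) - 1"

definition uq_relations :: "'a::field \<Rightarrow> ('a, uq_gen) free_alg set" where
  "uq_relations q =
     {gen gy * gen gyinv - 1, gen gyinv * gen gy - 1,
      qrel q gx gy, qrel q gy gz, qrel q gz gx}"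

definition uq_ideal :: "'a::field \<Rightarrow> ('a, uq_gen) free_alg set" where
  "uq_ideal q = genideal free_ring (uq_relations q)"

definition Uq :: "'a::field \<Rightarrow> ('a, uq_gen) free_alg set ring" where
  "Uq q = free_ring Quot (uq_ideal q)"

definition uq_class :: "'a::field \<Rightarrow> ('a, uq_gen) free_alg \<Rightarrow> ('a, uq_gen) free_alg set" where
  "uq_class q f = uq_ideal q +>\<^bsub>free_ring\<^esub> f"

text \<open>The structure map of the algebra, i.e. the scalar multiples of the unit.\<close>

definition uq_scalar :: "'a::field \<Rightarrow> 'a \<Rightarrow> ('a, uq_gen) free_alg set" where
  "uq_scalar q c = uq_class q (const c)"

definition uq_x :: "'a::field \<Rightarrow> ('a, uq_gen) free_alg set" where "uq_x q = uq_class q (gen gx)"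
definition uq_yinv :: "'a::field \<Rightarrow> ('a, uq_gen) free_alg set" where "uq_yinv q = uq_class q (gen gyinv)"
definition uq_z :: "'a::field \<Rightarrow> ('a, uq_gen) free_alg set" where "uq_z q = uq_class q (gen gz)"

text \<open>A subalgebra is a subring containing the scalars, so the generated subalgebra is the subring
  generated by the scalars together with the generators.\<close>

definition Uq_vee :: "'a::field \<Rightarrow> ('a, uq_gen) free_alg set ring" where
  "Uq_vee q =
     (Uq q)\<lparr>carrier := generate_ring (Uq q) (range (uq_scalar q) \<union> {uq_x q, uq_yinv q, uq_z q})\<rparr>"


text \<open>A module structure, on the subspace \<open>W\<close> of an ambient vector space, over the algebra with
  underlying ring \<open>A\<close> and structure map \<open>\<eta>\<close>: a unital algebra homomorphism from \<open>A\<close> to the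
  linear endomorphisms of \<open>W\<close>. Only the values \<open>\<rho> a v\<close> with \<open>a \<in> carrier A\<close> and \<open>v \<in> W\<close> matter.\<close>

definition alg_action ::
    "('u, 'm) ring_scheme \<Rightarrow> ('a::field \<Rightarrow> 'u) \<Rightarrow> ('a \<Rightarrow> 'v::ab_group_add \<Rightarrow> 'v) \<Rightarrow> 'v set
      \<Rightarrow> ('u \<Rightarrow> 'v \<Rightarrow> 'v) \<Rightarrow> bool" where
  "alg_action A \<eta> scale W \<rho> \<longleftrightarrow>
     module.subspace scale W \<and>
     (\<forall>a\<in>carrier A. \<forall>v\<in>W. \<rho> a v \<in> W) \<and>
     (\<forall>a\<in>carrier A. \<forall>v\<in>W. \<forall>w\<in>W. \<rho> a (v + w) = \<rho> a v + \<rho> a w) \<and>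
     (\<forall>a\<in>carrier A. \<forall>c. \<forall>v\<in>W. \<rho> a (scale c v) = scale c (\<rho> a v)) \<and>
     (\<forall>a\<in>carrier A. \<forall>b\<in>carrier A. \<forall>v\<in>W. \<rho> (a \<oplus>\<^bsub>A\<^esub> b) v = \<rho> a v + \<rho> b v) \<and>
     (\<forall>a\<in>carrier A. \<forall>b\<in>carrier A. \<forall>v\<in>W. \<rho> (a \<otimes>\<^bsub>A\<^esub> b) v = \<rho> a (\<rho> b v)) \<and>
     (\<forall>v\<in>W. \<rho> \<one>\<^bsub>A\<^esub> v = v) \<and>
     (\<forall>c. \<forall>v\<in>W. \<rho> (\<eta> c) v = scale c v)"

definition Uq_action ::
    "'a::field \<Rightarrow> ('a \<Rightarrow> 'v::ab_group_add
      \<Rightarrow> 'v) \<Rightarrow> 'v set \<Rightarrow> (('a, uq_gen) free_alg set \<Rightarrow> 'v \<Rightarrow> 'v) \<Rightarrow> bool" where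
  "Uq_action q = alg_action (Uq q) (uq_scalar q)"

definition Uq_vee_action ::
    "'a::field \<Rightarrow> ('a \<Rightarrow> 'v::ab_group_add
      \<Rightarrow> 'v) \<Rightarrow> 'v set \<Rightarrow> (('a, uq_gen) free_alg set \<Rightarrow> 'v \<Rightarrow> 'v) \<Rightarrow> bool" where
  "Uq_vee_action q = alg_action (Uq_vee q) (uq_scalar q)"

definition Uq_vee_submodule ::
    "'a::field \<Rightarrow> ('a \<Rightarrow> 'v::ab_group_add
      \<Rightarrow> 'v) \<Rightarrow> (('a, uq_gen) free_alg set \<Rightarrow> 'v \<Rightarrow> 'v) \<Rightarrow> 'v set \<Rightarrow> bool" where
  "Uq_vee_submodule q scale \<rho> W \<longleftrightarrow>
     module.subspace scale W \<and> (\<forall>a\<in>carrier (Uq_vee q). \<forall>v\<in>W. \<rho> a v \<in> W)"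

definition extends_to_Uq ::
    "'a::field \<Rightarrow> ('a \<Rightarrow> 'v::ab_group_add
      \<Rightarrow> 'v) \<Rightarrow> 'v set \<Rightarrow> (('a, uq_gen) free_alg set \<Rightarrow> 'v \<Rightarrow> 'v) \<Rightarrow> bool" where
  "extends_to_Uq q scale W \<rho> \<longleftrightarrow>
     (\<exists>\<rho>'. Uq_action q scale W \<rho>' \<and> (\<forall>a\<in>carrier (Uq_vee q). \<forall>v\<in>W. \<rho>' a v = \<rho> a v))"

definition module_direct_sum ::
    "'a::field \<Rightarrow> ('a \<Rightarrow> 'v::ab_group_add
      \<Rightarrow> 'v) \<Rightarrow> (('a, uq_gen) free_alg set \<Rightarrow> 'v \<Rightarrow> 'v) \<Rightarrow> 'v set \<Rightarrow> 'v set \<Rightarrow> bool" where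
  "module_direct_sum q scale \<rho> W1 W2 \<longleftrightarrow>
     Uq_vee_submodule q scale \<rho> W1 \<and> Uq_vee_submodule q scale \<rho> W2 \<and>
     {u + w | u w. u \<in> W1 \<and> w \<in> W2} = UNIV \<and> W1 \<inter> W2 = {0}"

definition invertible_part :: "('v \<Rightarrow> 'v) \<Rightarrow> 'v set" where
  "invertible_part T = (\<Inter>n. range (T ^^ n))"

definition nilpotent_part :: "('v::zero \<Rightarrow> 'v) \<Rightarrow> 'v set" where
  "nilpotent_part T = (\<Union>n. {v. (T ^^ n) v = 0})"

end

theory Submission
  imports Defs
begin

text \<open>Write \<open>K\<close> for $y^{-1}$. Multiplying the first two relations of $U_q(\mathfrak{sl}_2)$ by \<open>K\<close>
  on both sides eliminates \<open>y\<close> and gives $qKx - q^{-1}xK = (q - q^{-1})K^2 = qzK - q^{-1}Kz$.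
  Hence \<open>x\<close> and \<open>z\<close> preserve the range and the kernel of each power of \<open>K\<close>, so the Fitting
  decomposition of \<open>V\<close> with respect to \<open>K\<close> consists of submodules. On the invertible part the
  computation can be reversed: with \<open>y\<close> acting as the inverse of \<open>K\<close>, all defining relations
  hold. On a nonzero nilpotent part \<open>K\<close> is not injective, which rules out an action of \<open>y\<close>.\<close>

subsection \<open>The free algebra and its quotient\<close>

lemma free_ring_simps [simp]:
  "carrier free_ring = UNIV" "mult free_ring = (*)" "one free_ring = 1"
  "zero free_ring = 0" "add free_ring = (+)"
  by (simp_all add: free_ring_def)

lemma ring_free_ring: "ring (free_ring :: ('a::field, 'g) free_alg ring)"
proof (intro ringI abelian_groupI monoidI)
  fix x :: "('a, 'g) free_alg"
  show "\<exists>y\<in>carrier free_ring. y \<oplus>\<^bsub>free_ring\<^esub> x = \<zero>\<^bsub>free_ring\<^esub>"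
    by (rule bexI[of _ "- x"]) simp_all
qed (simp_all add: algebra_simps)

lemma minus_free_ring [simp]: "\<ominus>\<^bsub>free_ring\<^esub> (f :: ('a::field, 'g) free_alg) = - f"
proof -
  interpret R: ring "free_ring :: ('a, 'g) free_alg ring"
    by (rule ring_free_ring)
  show ?thesis
    by (metis R.minus_equality R.add.one_closed UNIV_I ab_left_minus free_ring_simps(1,4,5))
qed

text \<open>Negation is left multiplication by \<open>-1\<close>, so left absorption and closure
  under sums already give an additive subgroup.\<close>

lemma ideal_free_ringI:
  fixes I :: "('a::field, 'g) free_alg set"
  assumes "0 \<in> I" "\<And>f g. f \<in> I \<Longrightarrow> g \<in> I \<Longrightarrow> f + g \<in> I"
    and "\<And>f g. f \<in> I \<Longrightarrow> g * f \<in> I" "\<And>f g. f \<in> I \<Longrightarrow> f * g \<in> I"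
  shows "ideal I free_ring"
proof (rule idealI[OF ring_free_ring])
  interpret R: ring "free_ring :: ('a, 'g) free_alg ring"
    by (rule ring_free_ring)
  have "- f \<in> I" if "f \<in> I" for f
    using assms(3)[OF that, of "-1"] by simp
  then show "subgroup I (add_monoid free_ring)"
    using assms(1,2)
    by (intro R.add.subgroupI) (auto simp: a_inv_def[symmetric])
qed (use assms in auto)

lemma const_0 [simp]: "const 0 = 0"
  and const_1 [simp]: "const 1 = 1"
  and const_diff: "const (a - b) = const a - const b"
  and const_mult: "const (a * b) = const a * const b"
  by (simp_all add: const_def single_add single_diff mult_single)

text \<open>Reduces additive statements to monomials. The update rule adds a key outside the
  support, and there overwriting a coefficient is the same as adding a monomial.\<close>

lemma free_alg_induct [case_names zero single add]:
  fixes f :: "('a::field, 'g) free_alg"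
  assumes "P 0" "\<And>w c. P (Poly_Mapping.single w c)" "\<And>f g. P f \<Longrightarrow> P g \<Longrightarrow> P (f + g)"
  shows "P f"
proof (induction f rule: update_induct)
  case const
  show ?case by fact
next
  case (update f w c)
  then have "Poly_Mapping.lookup f w = 0"
    by (simp add: in_keys_iff)
  then have "Poly_Mapping.update w c f = f + Poly_Mapping.single w c"
    by (intro poly_mapping_eqI) (auto simp: lookup_update lookup_add lookup_single when_def)
  then show ?case
    using assms update by simp
qed

lemma const_central: "f * const c = const c * f"
  by (induction f rule: free_alg_induct)
     (simp_all add: const_def mult_single algebra_simps)

text \<open>With \<open>const_central\<close> this moves scalars to the left of noncommutative
  words, so that such words can be compared by simplification.\<close>

lemma const_left_commute: "f * (const c * g) = const c * (f * g)"
  by (metis const_central mult.assoc)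

context
  fixes q :: "'a::field"
begin

interpretation F: ring "free_ring :: ('a, uq_gen) free_alg ring"
  by (rule ring_free_ring)

lemma ideal_uq_ideal: "ideal (uq_ideal q) free_ring"
  unfolding uq_ideal_def by (rule F.genideal_ideal) simp

interpretation I: ideal "uq_ideal q" "free_ring :: ('a, uq_gen) free_alg ring"
  by (rule ideal_uq_ideal)

lemma uq_ideal_closed:
  "f \<in> uq_ideal q \<Longrightarrow> g \<in> uq_ideal q \<Longrightarrow> f + g \<in> uq_ideal q"
  "f \<in> uq_ideal q \<Longrightarrow> g \<in> uq_ideal q \<Longrightarrow> f - g \<in> uq_ideal q"
  "f \<in> uq_ideal q \<Longrightarrow> h * f \<in> uq_ideal q"
  "f \<in> uq_ideal q \<Longrightarrow> f * h \<in> uq_ideal q"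
  using I.a_closed[of f g] I.a_closed[of f "- g"] I.a_inv_closed[of g]
    I.I_l_closed[of f h] I.I_r_closed[of f h]
  by simp_all

lemma uq_relations_subset: "uq_relations q \<subseteq> uq_ideal q"
  unfolding uq_ideal_def by (rule F.genideal_self) simp

lemma uq_ideal_minimal: "ideal J free_ring \<Longrightarrow> uq_relations q \<subseteq> J \<Longrightarrow> uq_ideal q \<subseteq> J"
  unfolding uq_ideal_def by (rule F.genideal_minimal)

lemma ring_Uq: "ring (Uq q)"
  unfolding Uq_def by (rule I.quotient_is_ring)

lemma carrier_Uq: "carrier (Uq q) = range (uq_class q)"
  by (auto simp: Uq_def uq_class_def FactRing_def A_RCOSETS_def')

lemma uq_class_add: "uq_class q (f + g) = uq_class q f \<oplus>\<^bsub>Uq q\<^esub> uq_class q g"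
  using ring_hom_add[OF I.rcos_ring_hom, of f g] by (simp add: Uq_def uq_class_def)

lemma uq_class_mult: "uq_class q (f * g) = uq_class q f \<otimes>\<^bsub>Uq q\<^esub> uq_class q g"
  using ring_hom_mult[OF I.rcos_ring_hom, of f g] by (simp add: Uq_def uq_class_def)

lemma uq_class_1: "uq_class q 1 = \<one>\<^bsub>Uq q\<^esub>"
  using ring_hom_one[OF I.rcos_ring_hom] by (simp add: Uq_def uq_class_def)

lemma uq_class_eq_iff: "uq_class q f = uq_class q g \<longleftrightarrow> f - g \<in> uq_ideal q"
  using I.a_rcos_module[of g f] F.a_repr_independence[of f "uq_ideal q" g, OF _ _ I.a_subgroup]
    I.a_rcos_self[of f]
  by (auto simp: uq_class_def)

lemma uq_class_minus: "uq_class q (- f) = \<ominus>\<^bsub>Uq q\<^esub> uq_class q f"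
proof -
  interpret U: ring "Uq q" by (rule ring_Uq)
  \<comment> \<open>The class of \<open>0\<close> is idempotent under addition, hence the zero of
    the group.\<close>
  have "uq_class q 0 = \<zero>\<^bsub>Uq q\<^esub>"
    using uq_class_add[of 0 0] U.add.l_cancel_one[of "uq_class q 0" "uq_class q 0"]
    by (simp add: carrier_Uq)
  then show ?thesis
    using uq_class_add[of "- f" f] U.minus_equality[of "uq_class q (- f)" "uq_class q f"]
    by (simp add: carrier_Uq)
qed

end

subsection \<open>Actions of the free algebra\<close>

lemma alg_actionD:
  assumes "alg_action A \<eta> scale W \<rho>"
  shows alg_action_subspace: "module.subspace scale W"
    and alg_action_closed: "a \<in> carrier A \<Longrightarrow> v \<in> W \<Longrightarrow> \<rho> a v \<in> W"
    and alg_action_add_right: "a \<in> carrier A \<Longrightarrow> v \<in> W \<Longrightarrow> w \<in> W \<Longrightarrow> \<rho> a (v + w) = \<rho> a v + \<rho> a w"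
    and alg_action_scale_right: "a \<in> carrier A \<Longrightarrow> v \<in> W \<Longrightarrow> \<rho> a (scale c v) = scale c (\<rho> a v)"
    and alg_action_add_left:
      "a \<in> carrier A \<Longrightarrow> b \<in> carrier A \<Longrightarrow> v \<in> W \<Longrightarrow> \<rho> (a \<oplus>\<^bsub>A\<^esub> b) v = \<rho> a v + \<rho> b v"
    and alg_action_mult:
      "a \<in> carrier A \<Longrightarrow> b \<in> carrier A \<Longrightarrow> v \<in> W \<Longrightarrow> \<rho> (a \<otimes>\<^bsub>A\<^esub> b) v = \<rho> a (\<rho> b v)"
    and alg_action_one: "v \<in> W \<Longrightarrow> \<rho> \<one>\<^bsub>A\<^esub> v = v"
    and alg_action_scalar: "v \<in> W \<Longrightarrow> \<rho> (\<eta> c) v = scale c v"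
  using assms unfolding alg_action_def by blast+

text \<open>The evaluation behind the universal property of the free algebra: letters become
  operators, words their composites. \<open>foldr\<close> lets the last letter act first, as a left
  module requires.\<close>

definition free_eval ::
    "('a::field \<Rightarrow> 'v::ab_group_add \<Rightarrow> 'v) \<Rightarrow> ('g \<Rightarrow> 'v \<Rightarrow> 'v) \<Rightarrow> ('a, 'g) free_alg \<Rightarrow> 'v \<Rightarrow> 'v" where
  "free_eval scale T f v =
     (\<Sum>w\<in>Poly_Mapping.keys f. scale (Poly_Mapping.lookup f w) (foldr T (letters w) v))"

context vector_space
begin

lemma free_eval_single:
  "free_eval scale T (Poly_Mapping.single w c) v = scale c (foldr T (letters w) v)"
  by (cases "c = 0") (simp_all add: free_eval_def)

lemma free_eval_0: "free_eval scale T 0 v = 0"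
  by (simp add: free_eval_def)

lemma free_eval_add: "free_eval scale T (f + g) v = free_eval scale T f v + free_eval scale T g v"
  unfolding free_eval_def
  by (rule setsum_keys_plus_distrib) (simp_all add: scale_left_distrib)

lemma free_eval_gen: "free_eval scale T (gen g) v = T g v"
  by (simp add: gen_def free_eval_single)

lemma free_eval_const: "free_eval scale T (const c) v = scale c v"
  by (simp add: const_def free_eval_single zero_free_word_def)

context
  fixes W :: "'b set" and T :: "'g \<Rightarrow> 'b \<Rightarrow> 'b"
  assumes W: "subspace W"
    and T_closed: "\<And>g v. v \<in> W \<Longrightarrow> T g v \<in> W"
    and T_add: "\<And>g v w. v \<in> W \<Longrightarrow> w \<in> W \<Longrightarrow> T g (v + w) = T g v + T g w"
    and T_scale: "\<And>g v c. v \<in> W \<Longrightarrow> T g (scale c v) = scale c (T g v)"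
begin

lemma foldr_closed: "v \<in> W \<Longrightarrow> foldr T xs v \<in> W"
  by (induction xs) (simp_all add: T_closed)

lemma foldr_add: "v \<in> W \<Longrightarrow> w \<in> W \<Longrightarrow> foldr T xs (v + w) = foldr T xs v + foldr T xs w"
  by (induction xs) (simp_all add: T_add foldr_closed)

lemma foldr_scale: "v \<in> W \<Longrightarrow> foldr T xs (scale c v) = scale c (foldr T xs v)"
  by (induction xs) (simp_all add: T_scale foldr_closed)

lemma free_eval_closed: "v \<in> W \<Longrightarrow> free_eval scale T f v \<in> W"
  unfolding free_eval_def
  by (intro subspace_sum[OF W] subspace_scale[OF W] foldr_closed)

lemma free_eval_add_right:
  "v \<in> W \<Longrightarrow> w \<in> W \<Longrightarrow> free_eval scale T f (v + w) = free_eval scale T f v + free_eval scale T f w"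
  by (simp add: free_eval_def foldr_add scale_right_distrib sum.distrib)

lemma free_eval_scale_right:
  "v \<in> W \<Longrightarrow> free_eval scale T f (scale c v) = scale c (free_eval scale T f v)"
  by (simp add: free_eval_def foldr_scale scale_sum_right mult.commute)

text \<open>Both sides are additive in \<open>f\<close> and in \<open>g\<close>, which leaves two
  monomials; there concatenating words is composing operators.\<close>

lemma free_eval_mult:
  assumes "v \<in> W"
  shows "free_eval scale T (f * g) v = free_eval scale T f (free_eval scale T g v)"
proof (induction f rule: free_alg_induct)
  case zero
  show ?case by (simp add: free_eval_0)
next
  case (single w c)
  show ?case
  proof (induction g rule: free_alg_induct)
    case zero
    show ?case
      using foldr_scale[OF assms, of _ 0] by (simp add: free_eval_0 free_eval_single)
  next
    case (single w' c')
    show ?case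
      using assms
      by (simp add: mult_single free_eval_single plus_free_word_def foldr_scale foldr_closed)
  next
    case (add g1 g2)
    then show ?case
      using assms
      by (simp add: distrib_left free_eval_add free_eval_add_right free_eval_closed)
  qed
next
  case (add f1 f2)
  then show ?case
    by (simp add: distrib_right free_eval_add)
qed

text \<open>Linearity of the operators is asked for on \<open>W\<close> only. This matters later,
  when one letter acts by an inverse that is meaningful only there.\<close>

lemma alg_action_free_eval: "alg_action free_ring const scale W (free_eval scale T)"
  unfolding alg_action_def
  using W free_eval_const[of T 1]
  by (simp add: free_eval_closed free_eval_add_right free_eval_scale_right free_eval_add
      free_eval_mult free_eval_const)

end

lemma alg_action_diff_left:
  assumes "alg_action free_ring const scale W E" "v \<in> W"
  shows "E (f - g) v = E f v - E g v"
  using alg_action_add_left[OF assms(1) _ _ assms(2), of "f - g" g] by simp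

text \<open>The annihilator of \<open>W\<close> is a two-sided ideal. Once it contains the relations
  it contains the ideal they generate, and the action of a class no longer depends on the
  representative.\<close>

lemma Uq_action_of_free_action:
  assumes E: "alg_action free_ring const scale W E"
    and rel: "\<And>r v. r \<in> uq_relations q \<Longrightarrow> v \<in> W \<Longrightarrow> E r v = 0"
  obtains \<rho> where "Uq_action q scale W \<rho>" "\<And>f v. v \<in> W \<Longrightarrow> \<rho> (uq_class q f) v = E f v"
proof -
  \<comment> \<open>An arbitrary representative is picked for each class; \<open>kill\<close> below
    makes the choice immaterial on \<open>W\<close>.\<close>
  define \<rho> where "\<rho> a = E (SOME f. uq_class q f = a)" for a
  have W: "subspace W"
    by (rule alg_action_subspace[OF E])
  have E0: "E f 0 = 0" for f
    using alg_action_scale_right[OF E, of f 0 0] subspace_0[OF W] by simp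
  \<comment> \<open>Right absorption holds because \<open>W\<close> is invariant, left absorption
    because every element fixes the zero vector. The difference rule for \<open>0 - 0\<close> shows
    that \<open>0\<close> annihilates \<open>W\<close>.\<close>
  have "ideal {f. \<forall>v\<in>W. E f v = 0} free_ring"
    using alg_action_add_left[OF E] alg_action_mult[OF E] alg_action_closed[OF E] E0
      alg_action_diff_left[OF E, of _ 0 0]
    by (intro ideal_free_ringI) simp_all
  then have kill: "E f v = 0" if "f \<in> uq_ideal q" "v \<in> W" for f v
    using uq_ideal_minimal[of "{f. \<forall>v\<in>W. E f v = 0}" q] rel that by blast
  have \<rho>: "\<rho> (uq_class q f) v = E f v" if "v \<in> W" for f v
  proof -
    have "uq_class q (SOME g. uq_class q g = uq_class q f) = uq_class q f"
      by (rule someI) (rule refl)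
    then show ?thesis
      unfolding uq_class_eq_iff \<rho>_def
      using kill alg_action_diff_left[OF E] that by fastforce
  qed
  have "Uq_action q scale W \<rho>"
    unfolding Uq_action_def alg_action_def
    using W subspace_add[OF W] subspace_scale[OF W] alg_action_closed[OF E] alg_action_add_right[OF E] alg_action_scale_right[OF E]
      alg_action_add_left[OF E] alg_action_mult[OF E] alg_action_one[OF E] alg_action_scalar[OF E]
    by (auto simp: carrier_Uq \<rho> uq_scalar_def simp flip: uq_class_add uq_class_mult uq_class_1)
  then show thesis
    using \<rho> that by blast
qed

end

subsection \<open>Relations in the subalgebra\<close>

context
  fixes q :: "'a::field"
  assumes q: "q - inverse q \<noteq> 0"
begin

text \<open>The ideal absorbs constants, so it contains this cleared form whenever it contains
  \<open>qrel q a b\<close>; the word calculations below can then avoid the denominator.\<close>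

lemma qrel_cleared:
  "const (q - inverse q) * qrel q a b =
     const q * gen a * gen b - const (inverse q) * gen b * gen a - const (q - inverse q)"
proof -
  have "const (q - inverse q) * (const (inverse (q - inverse q)) * f) = (f :: ('a, uq_gen) free_alg)" for f
    using q by (simp flip: mult.assoc const_mult)
  then show ?thesis
    by (simp add: qrel_def right_diff_distrib mult.assoc)
qed

lemma yinv_x_relation:
  "const q * gen gyinv * gen gx - const (inverse q) * gen gx * gen gyinv
     - const (q - inverse q) * gen gyinv * gen gyinv \<in> uq_ideal q"
proof -
  let ?A = "gen gyinv :: ('a, uq_gen) free_alg" and ?x = "gen gx :: ('a, uq_gen) free_alg"
    and ?y = "gen gy :: ('a, uq_gen) free_alg"
  let ?D = "const q * ?x * ?y - const (inverse q) * ?y * ?x - const (q - inverse q)"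
  have 1: "?y * ?A - 1 \<in> uq_ideal q" "?A * ?y - 1 \<in> uq_ideal q" "qrel q gx gy \<in> uq_ideal q"
    using uq_relations_subset[of q] by (auto simp: uq_relations_def)
  then have "?D \<in> uq_ideal q"
    using uq_ideal_closed(3) by (simp flip: qrel_cleared)
  \<comment> \<open>In \<open>A * D * A\<close> the words \<open>A x y A\<close> and
    \<open>A y x A\<close> occur. The two correction terms, multiples of \<open>y A - 1\<close> and
    \<open>A y - 1\<close>, replace them by \<open>A x\<close> and \<open>x A\<close>.\<close>
  then have "?A * ?D * ?A - const q * ?A * ?x * (?y * ?A - 1)
      + (?A * ?y - 1) * (const (inverse q) * ?x * ?A) \<in> uq_ideal q"
    using 1 by (simp only: uq_ideal_closed)
  also have "?A * ?D * ?A - const q * ?A * ?x * (?y * ?A - 1)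
      + (?A * ?y - 1) * (const (inverse q) * ?x * ?A) =
      const q * ?A * ?x - const (inverse q) * ?x * ?A - const (q - inverse q) * ?A * ?A"
    by (simp add: algebra_simps const_left_commute const_central[of "gen _"])
  finally show ?thesis .
qed

text \<open>The same sandwich as for \<open>x\<close>. Since \<open>y\<close> precedes
  \<open>z\<close> in the leading term, the cancellations fall on the opposite sides, and
  \<open>z\<close> ends up to the left of \<open>y^-1\<close> in the term with coefficient
  \<open>q\<close>.\<close>

lemma z_yinv_relation:
  "const q * gen gz * gen gyinv - const (inverse q) * gen gyinv * gen gz
     - const (q - inverse q) * gen gyinv * gen gyinv \<in> uq_ideal q"
proof -
  let ?A = "gen gyinv :: ('a, uq_gen) free_alg" and ?z = "gen gz :: ('a, uq_gen) free_alg"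
    and ?y = "gen gy :: ('a, uq_gen) free_alg"
  let ?D = "const q * ?y * ?z - const (inverse q) * ?z * ?y - const (q - inverse q)"
  have 1: "?y * ?A - 1 \<in> uq_ideal q" "?A * ?y - 1 \<in> uq_ideal q" "qrel q gy gz \<in> uq_ideal q"
    using uq_relations_subset[of q] by (auto simp: uq_relations_def)
  then have "?D \<in> uq_ideal q"
    using uq_ideal_closed(3) by (simp flip: qrel_cleared)
  then have "?A * ?D * ?A - (?A * ?y - 1) * (const q * ?z * ?A)
      + const (inverse q) * ?A * ?z * (?y * ?A - 1) \<in> uq_ideal q"
    using 1 by (simp only: uq_ideal_closed)
  also have "?A * ?D * ?A - (?A * ?y - 1) * (const q * ?z * ?A)
      + const (inverse q) * ?A * ?z * (?y * ?A - 1) =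
      const q * ?z * ?A - const (inverse q) * ?A * ?z - const (q - inverse q) * ?A * ?A"
    by (simp add: algebra_simps const_left_commute const_central[of "gen _"])
  finally show ?thesis .
qed

lemma z_x_relation:
  "const q * gen gz * gen gx - const (inverse q) * gen gx * gen gz - const (q - inverse q) \<in> uq_ideal q"
proof -
  have "qrel q gz gx \<in> uq_ideal q"
    using uq_relations_subset[of q] by (auto simp: uq_relations_def)
  then show ?thesis
    using uq_ideal_closed(3) by (simp flip: qrel_cleared)
qed

end

section \<open>Induction and membership in the generated subalgebra\<close>

lemma vee_generators_subset:
  "range (uq_scalar q) \<union> {uq_x q, uq_yinv q, uq_z q} \<subseteq> carrier (Uq q)"
  by (auto simp: carrier_Uq uq_scalar_def uq_x_def uq_yinv_def uq_z_def)

lemma vee_carrier_subset: "carrier (Uq_vee q) \<subseteq> carrier (Uq q)"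
  using ring.generate_ring_incl[OF ring_Uq vee_generators_subset] by (simp add: Uq_vee_def)

lemma vee_simps [simp]:
  "mult (Uq_vee q) = mult (Uq q)" "add (Uq_vee q) = add (Uq q)" "one (Uq_vee q) = one (Uq q)"
  by (simp_all add: Uq_vee_def)

lemma uq_class_minus_eq: "uq_class q (- f) = uq_class q (const (- 1)) \<otimes>\<^bsub>Uq q\<^esub> uq_class q f"
proof -
  have "const (-1) = (-1 :: ('a, uq_gen) free_alg)"
    using const_diff[of 0 1] by simp
  then show ?thesis
    by (simp flip: uq_class_mult)
qed

text \<open>Negation is multiplication by the scalar \<open>-1\<close>, so it needs no case of its own.\<close>

lemma vee_induct [consumes 1, case_names scalar x yinv z add mult]:
  assumes "a \<in> carrier (Uq_vee q)"
    and scalar: "\<And>c. P (uq_scalar q c)"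
    and gens: "P (uq_x q)" "P (uq_yinv q)" "P (uq_z q)"
    and add: "\<And>a b. a \<in> carrier (Uq_vee q) \<Longrightarrow> b \<in> carrier (Uq_vee q) \<Longrightarrow> P a \<Longrightarrow> P b
      \<Longrightarrow> P (a \<oplus>\<^bsub>Uq q\<^esub> b)"
    and mult: "\<And>a b. a \<in> carrier (Uq_vee q) \<Longrightarrow> b \<in> carrier (Uq_vee q) \<Longrightarrow> P a \<Longrightarrow> P b
      \<Longrightarrow> P (a \<otimes>\<^bsub>Uq q\<^esub> b)"
  shows "P a"
proof -
  let ?G = "range (uq_scalar q) \<union> {uq_x q, uq_yinv q, uq_z q}"
  have carr: "carrier (Uq_vee q) = generate_ring (Uq q) ?G"
    by (simp add: Uq_vee_def)
  show ?thesis
    using assms(1) unfolding carr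
  proof (induction rule: generate_ring.induct)
    case one
    show ?case
      using scalar[of 1] by (simp add: uq_scalar_def uq_class_1)
  next
    case (incl h)
    then show ?case
      using scalar gens by auto
  next
    case (a_inv h)
    have "h \<in> carrier (Uq q)"
      using vee_carrier_subset[of q] a_inv.hyps carr by blast
    then have "\<ominus>\<^bsub>Uq q\<^esub> h = uq_scalar q (- 1) \<otimes>\<^bsub>Uq q\<^esub> h"
      by (auto simp: carrier_Uq uq_scalar_def simp flip: uq_class_minus uq_class_minus_eq)
    moreover have "uq_scalar q (- 1) \<in> carrier (Uq_vee q)"
      unfolding carr by (intro generate_ring.incl) simp
    ultimately show ?case
      using mult[of "uq_scalar q (- 1)" h] scalar a_inv carr by simp
  qed (use add mult carr in auto)
qed

text \<open>Phrased through representatives, so that membership can be decided by following the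
  syntax of a word polynomial.\<close>

lemma vee_closed [simp]:
  "uq_class q (const c) \<in> carrier (Uq_vee q)"
  "uq_class q (gen gx) \<in> carrier (Uq_vee q)"
  "uq_class q (gen gyinv) \<in> carrier (Uq_vee q)"
  "uq_class q (gen gz) \<in> carrier (Uq_vee q)"
  "uq_class q f \<in> carrier (Uq_vee q) \<Longrightarrow> uq_class q g \<in> carrier (Uq_vee q)
    \<Longrightarrow> uq_class q (f * g) \<in> carrier (Uq_vee q)"
  "uq_class q f \<in> carrier (Uq_vee q) \<Longrightarrow> uq_class q g \<in> carrier (Uq_vee q)
    \<Longrightarrow> uq_class q (f + g) \<in> carrier (Uq_vee q)"
  "uq_class q f \<in> carrier (Uq_vee q) \<Longrightarrow> uq_class q (- f) \<in> carrier (Uq_vee q)"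
  by (simp_all add: Uq_vee_def uq_class_mult uq_class_add uq_class_minus generate_ring.intros
      flip: uq_scalar_def uq_x_def uq_yinv_def uq_z_def)

lemma vee_closed_diff [simp]:
  "uq_class q f \<in> carrier (Uq_vee q) \<Longrightarrow> uq_class q g \<in> carrier (Uq_vee q)
    \<Longrightarrow> uq_class q (f - g) \<in> carrier (Uq_vee q)"
  using vee_closed(6)[of q f "- g"] by simp

section \<open>Operator identities in modules over the subalgebra\<close>

context vector_space
begin

context
  fixes q :: 'a and W :: "'b set" and \<rho> :: "('a, uq_gen) free_alg set \<Rightarrow> 'b \<Rightarrow> 'b"
  assumes \<rho>: "Uq_vee_action q scale W \<rho>"
begin

lemmas vee_act = \<rho>[unfolded Uq_vee_action_def]

lemma vee_act_mult:
  assumes "uq_class q f \<in> carrier (Uq_vee q)" "uq_class q g \<in> carrier (Uq_vee q)" "v \<in> W"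
  shows "\<rho> (uq_class q (f * g)) v = \<rho> (uq_class q f) (\<rho> (uq_class q g) v)"
  using alg_action_mult[OF vee_act assms] by (simp add: uq_class_mult)

lemma vee_act_diff:
  assumes "uq_class q f \<in> carrier (Uq_vee q)" "uq_class q g \<in> carrier (Uq_vee q)" "v \<in> W"
  shows "\<rho> (uq_class q (f - g)) v = \<rho> (uq_class q f) v - \<rho> (uq_class q g) v"
  using alg_action_add_left[OF vee_act vee_closed_diff[OF assms(1,2)] assms(2,3)]
  by (simp flip: uq_class_add)

lemma vee_act_const: "v \<in> W \<Longrightarrow> \<rho> (uq_class q (const c)) v = scale c v"
  using alg_action_scalar[OF vee_act] by (simp add: uq_scalar_def)

lemma vee_act_closed: "uq_class q f \<in> carrier (Uq_vee q) \<Longrightarrow> v \<in> W \<Longrightarrow> \<rho> (uq_class q f) v \<in> W"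
  by (rule alg_action_closed[OF vee_act])

text \<open>Every element of the ideal has the class of the scalar \<open>0\<close>, which lies in
  the subalgebra. Hence relations derived with the help of \<open>gy\<close> also bind modules on
  which \<open>gy\<close> does not act.\<close>

lemma vee_act_eq_0:
  assumes "f \<in> uq_ideal q" "v \<in> W"
  shows "\<rho> (uq_class q f) v = 0"
proof -
  have "uq_class q f = uq_class q (const 0)"
    using assms by (simp add: uq_class_eq_iff)
  then show ?thesis
    using vee_act_const[OF assms(2), of 0] by simp
qed

context
  assumes q: "q - inverse q \<noteq> 0"
begin

lemma vee_act_yinv_x:
  assumes "v \<in> W"
  shows "scale q (\<rho> (uq_yinv q) (\<rho> (uq_x q) v)) - scale (inverse q) (\<rho> (uq_x q) (\<rho> (uq_yinv q) v))
    = scale (q - inverse q) (\<rho> (uq_yinv q) (\<rho> (uq_yinv q) v))"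
  using vee_act_eq_0[OF yinv_x_relation[OF q] assms] assms
  by (simp add: vee_act_mult vee_act_diff vee_act_const vee_act_closed uq_x_def uq_yinv_def)

lemma vee_act_z_yinv:
  assumes "v \<in> W"
  shows "scale q (\<rho> (uq_z q) (\<rho> (uq_yinv q) v)) - scale (inverse q) (\<rho> (uq_yinv q) (\<rho> (uq_z q) v))
    = scale (q - inverse q) (\<rho> (uq_yinv q) (\<rho> (uq_yinv q) v))"
  using vee_act_eq_0[OF z_yinv_relation[OF q] assms] assms
  by (simp add: vee_act_mult vee_act_diff vee_act_const vee_act_closed uq_z_def uq_yinv_def)

lemma vee_act_z_x:
  assumes "v \<in> W"
  shows "scale q (\<rho> (uq_z q) (\<rho> (uq_x q) v)) - scale (inverse q) (\<rho> (uq_x q) (\<rho> (uq_z q) v))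
    = scale (q - inverse q) v"
  using vee_act_eq_0[OF z_x_relation[OF q] assms] assms
  by (simp add: vee_act_mult vee_act_diff vee_act_const vee_act_closed uq_z_def uq_x_def)

end

end

end

subsection \<open>Submodules and extensions\<close>

context vector_space
begin

lemma Uq_vee_action_submodule:
  assumes \<rho>: "Uq_vee_action q scale UNIV \<rho>" and W: "Uq_vee_submodule q scale \<rho> W"
  shows "Uq_vee_action q scale W \<rho>"
  using assms unfolding Uq_vee_action_def alg_action_def Uq_vee_submodule_def by simp

lemma Uq_vee_submoduleI:
  assumes \<rho>: "Uq_vee_action q scale UNIV \<rho>" and W: "subspace W"
    and gens: "\<And>v. v \<in> W \<Longrightarrow> \<rho> (uq_x q) v \<in> W" "\<And>v. v \<in> W \<Longrightarrow> \<rho> (uq_yinv q) v \<in> W"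
      "\<And>v. v \<in> W \<Longrightarrow> \<rho> (uq_z q) v \<in> W"
  shows "Uq_vee_submodule q scale \<rho> W"
proof -
  note act = \<rho>[unfolded Uq_vee_action_def]
  have "\<forall>v\<in>W. \<rho> a v \<in> W" if "a \<in> carrier (Uq_vee q)" for a
    using that
  proof (induction rule: vee_induct)
    case (scalar c)
    then show ?case
      using alg_action_scalar[OF act] subspace_scale[OF W] by simp
  next
    case (add a b)
    then show ?case
      using alg_action_add_left[OF act, of a b] subspace_add[OF W] by simp
  next
    case (mult a b)
    then show ?case
      using alg_action_mult[OF act, of a b] by simp
  qed (use gens in auto)
  then show ?thesis
    using W by (simp add: Uq_vee_submodule_def)
qed

text \<open>The relation \<open>y y^-1 = 1\<close> turns the action of \<open>y\<close> into a left
  inverse of the action of \<open>y^-1\<close> on \<open>W\<close>.\<close>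

lemma extends_to_Uq_imp_inj_on:
  assumes "extends_to_Uq q scale W \<rho>"
  shows "inj_on (\<rho> (uq_yinv q)) W"
proof -
  obtain \<rho>' where act: "alg_action (Uq q) (uq_scalar q) scale W \<rho>'"
    and eq: "\<And>a v. a \<in> carrier (Uq_vee q) \<Longrightarrow> v \<in> W \<Longrightarrow> \<rho>' a v = \<rho> a v"
    using assms unfolding extends_to_Uq_def Uq_action_def by blast
  have "gen gy * gen gyinv - 1 \<in> uq_ideal q"
    using uq_relations_subset[of q] by (auto simp: uq_relations_def)
  then have "uq_class q (gen gy * gen gyinv) = \<one>\<^bsub>Uq q\<^esub>"
    by (simp add: uq_class_eq_iff flip: uq_class_1)
  then have "\<rho>' (uq_class q (gen gy)) (\<rho> (uq_yinv q) v) = v" if "v \<in> W" for v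
    using that alg_action_mult[OF act, of "uq_class q (gen gy)" "uq_yinv q" v]
      alg_action_one[OF act] eq[of "uq_yinv q" v]
    by (simp add: uq_class_mult carrier_Uq uq_yinv_def)
  then show ?thesis
    by (rule inj_on_inverseI)
qed

lemma extends_to_UqI:
  assumes \<rho>: "Uq_vee_action q scale W \<rho>" and q: "q - inverse q \<noteq> 0"
    and bij: "bij_betw (\<rho> (uq_yinv q)) W W"
  shows "extends_to_Uq q scale W \<rho>"
proof -
  note act = \<rho>[unfolded Uq_vee_action_def]
  define X where "X = \<rho> (uq_x q)"
  define K where "K = \<rho> (uq_yinv q)"
  define Z where "Z = \<rho> (uq_z q)"
  \<comment> \<open>The future action of \<open>y\<close>. It inverts \<open>K\<close> on
    \<open>W\<close> only; its values elsewhere are irrelevant to an action on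
    \<open>W\<close>.\<close>
  define Y where "Y = inv_into W K"
  have W: "subspace W"
    by (rule alg_action_subspace[OF act])
  have gens: "uq_x q \<in> carrier (Uq_vee q)" "uq_yinv q \<in> carrier (Uq_vee q)" "uq_z q \<in> carrier (Uq_vee q)"
    by (simp_all add: uq_x_def uq_yinv_def uq_z_def)
  have closed: "X v \<in> W" "K v \<in> W" "Z v \<in> W" if "v \<in> W" for v
    using that alg_action_closed[OF act] gens by (simp_all add: X_def K_def Z_def)
  have add: "X (v + w) = X v + X w" "K (v + w) = K v + K w" "Z (v + w) = Z v + Z w"
    if "v \<in> W" "w \<in> W" for v w
    using that alg_action_add_right[OF act] gens by (simp_all add: X_def K_def Z_def)
  have scale: "X (scale c v) = scale c (X v)" "K (scale c v) = scale c (K v)"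
      "Z (scale c v) = scale c (Z v)" if "v \<in> W" for c v
    using that alg_action_scale_right[OF act] gens by (simp_all add: X_def K_def Z_def)
  have K: "inj_on K W" "K ` W = W"
    using bij by (simp_all add: K_def bij_betw_def)
  have Y: "Y v \<in> W" "K (Y v) = v" "Y (K v) = v" if "v \<in> W" for v
    using that K inv_into_into[of v K W] f_inv_into_f[of v K W] inv_into_f_f[of K W v]
    by (simp_all add: Y_def)
  \<comment> \<open>Identities involving \<open>Y\<close> are proved by applying \<open>K\<close> to
    both sides and cancelling it by injectivity.\<close>
  have K_cancel: "v = w" if "K v = K w" "v \<in> W" "w \<in> W" for v w
    using K(1) that by (rule inj_onD)
  have Y_add: "Y (v + w) = Y v + Y w" if "v \<in> W" "w \<in> W" for v w
    using that by - (rule K_cancel; simp add: Y add subspace_add[OF W])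
  have Y_scale: "Y (scale c v) = scale c (Y v)" if "v \<in> W" for c v
    using that by - (rule K_cancel; simp add: Y scale subspace_scale[OF W])
  have K_diff: "K (v - w) = K v - K w" if "v \<in> W" "w \<in> W" for v w
    using add(2)[of "v - w" w] that subspace_diff[OF W] by simp
  have KX: "scale q (K (X v)) - scale (inverse q) (X (K v)) = scale (q - inverse q) (K (K v))"
    and ZK: "scale q (Z (K v)) - scale (inverse q) (K (Z v)) = scale (q - inverse q) (K (K v))"
    and ZX: "scale q (Z (X v)) - scale (inverse q) (X (Z v)) = scale (q - inverse q) v"
    if "v \<in> W" for v
    unfolding X_def K_def Z_def
    by (fact vee_act_yinv_x[OF \<rho> q that] vee_act_z_yinv[OF \<rho> q that] vee_act_z_x[OF \<rho> q that])+
  \<comment> \<open>This reverses the elimination of \<open>y\<close>: after applying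
    \<open>K\<close>, the claim is \<open>KX\<close> at \<open>Y v\<close>, where
    \<open>K (Y v)\<close> collapses to \<open>v\<close>. The identity \<open>YZ\<close> follows
    from \<open>ZK\<close> in the same way.\<close>
  have XY: "scale q (X (Y v)) - scale (inverse q) (Y (X v)) = scale (q - inverse q) v" if "v \<in> W" for v
    using KX[of "Y v"] that
    by - (rule K_cancel;
      simp add: K_diff scale Y closed subspace_diff[OF W] subspace_scale[OF W])
  have YZ: "scale q (Y (Z v)) - scale (inverse q) (Z (Y v)) = scale (q - inverse q) v" if "v \<in> W" for v
    using ZK[of "Y v"] that
    by - (rule K_cancel;
      simp add: K_diff scale Y closed subspace_diff[OF W] subspace_scale[OF W])

  \<comment> \<open>The operators follow the constructor order of \<open>uq_gen\<close>: x, y, y^-1,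
    z.\<close>
  define E where "E = free_eval scale (case_uq_gen X Y K Z)"
  have T: "case_uq_gen X Y K Z g v \<in> W"
    "w \<in> W \<Longrightarrow> case_uq_gen X Y K Z g (v + w) = case_uq_gen X Y K Z g v + case_uq_gen X Y K Z g w"
    "case_uq_gen X Y K Z g (scale c v) = scale c (case_uq_gen X Y K Z g v)" if "v \<in> W" for g v w c
    using that closed add scale Y Y_add Y_scale by (cases g; simp)+
  have E: "alg_action free_ring const scale W E"
    unfolding E_def by (rule alg_action_free_eval) (use W T in auto)
  have E_gen: "E (gen g) v = case_uq_gen X Y K Z g v" for g v
    unfolding E_def by (rule free_eval_gen)
  note E_simps = alg_action_mult[OF E, simplified] alg_action_diff_left[OF E]
    alg_action_one[OF E, simplified] alg_action_scalar[OF E] alg_action_closed[OF E, simplified] E_gen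
  \<comment> \<open>The outer factor \<open>inverse (q - inverse q)\<close> cancels the scalar on
    the right of the hypothesis, leaving \<open>v - v\<close>.\<close>
  have qrel: "E (qrel q a b) v = 0"
    if "v \<in> W" "scale q (E (gen a) (E (gen b) v)) - scale (inverse q) (E (gen b) (E (gen a) v))
      = scale (q - inverse q) v" for a b v
    using that q alg_action_closed[OF E, simplified] subspace_diff[OF W] subspace_scale[OF W]
    unfolding qrel_def mult.assoc
    by (simp add: alg_action_mult[OF E, simplified] alg_action_diff_left[OF E]
        alg_action_one[OF E, simplified] alg_action_scalar[OF E])
  have "E r v = 0" if "r \<in> uq_relations q" "v \<in> W" for r v
    using that XY[of v] YZ[of v] ZX[of v] Y[of v] unfolding uq_relations_def
    by (auto simp: E_simps intro!: qrel)
  then obtain \<rho>' where \<rho>': "Uq_action q scale W \<rho>'"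
    and E': "\<And>f v. v \<in> W \<Longrightarrow> \<rho>' (uq_class q f) v = E f v"
    using Uq_action_of_free_action[OF E] by blast
  note act' = \<rho>'[unfolded Uq_action_def]
  \<comment> \<open>Both actions respect sums and products, so agreement on scalars and the three
    generators spreads to the whole subalgebra.\<close>
  have "\<forall>v\<in>W. \<rho>' a v = \<rho> a v" if "a \<in> carrier (Uq_vee q)" for a
    using that
  proof (induction rule: vee_induct)
    case (scalar c)
    then show ?case
      by (simp add: alg_action_scalar[OF act] alg_action_scalar[OF act'])
  next
    case x
    then show ?case
      using E'[of _ "gen gx"] by (simp add: E_gen X_def uq_x_def)
  next
    case yinv
    then show ?case
      using E'[of _ "gen gyinv"] by (simp add: E_gen K_def uq_yinv_def)
  next
    case z
    then show ?case
      using E'[of _ "gen gz"] by (simp add: E_gen Z_def uq_z_def)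
  next
    case (add a b)
    then show ?case
      using alg_action_add_left[OF act, of a b] alg_action_add_left[OF act', of a b]
        add.hyps[THEN subsetD[OF vee_carrier_subset]] add.IH by simp
  next
    case (mult a b)
    then show ?case
      using alg_action_mult[OF act, of a b] alg_action_mult[OF act', of a b]
        alg_action_closed[OF act, of b] mult.hyps[THEN subsetD[OF vee_carrier_subset]] mult.IH
      by simp
  qed
  then show ?thesis
    unfolding extends_to_Uq_def using \<rho>' by blast
qed

end

subsection \<open>Fitting decomposition\<close>

context vector_space
begin

context
  fixes K :: "'b \<Rightarrow> 'b"
  assumes K_add: "\<And>v w. K (v + w) = K v + K w"
    and K_scale: "\<And>c v. K (scale c v) = scale c (K v)"
begin

lemma funpow_add_right: "(K ^^ n) (v + w) = (K ^^ n) v + (K ^^ n) w"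
  by (induction n) (simp_all add: K_add)

lemma funpow_scale_right: "(K ^^ n) (scale c v) = scale c ((K ^^ n) v)"
  by (induction n) (simp_all add: K_scale)

lemma funpow_0_right: "(K ^^ n) 0 = 0"
  using funpow_scale_right[of n 0 0] by simp

lemma funpow_diff_right: "(K ^^ n) (v - w) = (K ^^ n) v - (K ^^ n) w"
  using funpow_add_right[of n "v - w" w] by simp

lemma subspace_range_funpow: "subspace (range (K ^^ n))"
proof (rule subspaceI)
  show "0 \<in> range (K ^^ n)"
    using funpow_0_right by (metis rangeI)
qed (auto simp flip: funpow_add_right funpow_scale_right)

lemma subspace_kernel_funpow: "subspace {v. (K ^^ n) v = 0}"
  by (rule subspaceI) (simp_all add: funpow_0_right funpow_add_right funpow_scale_right)

text \<open>The first assumption pulls a factor \<open>K\<close> out to the left of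
  \<open>X\<close>, at the cost of a term that starts with \<open>K\<close> anyway. Repeating this
  extracts all of \<open>K ^^ n\<close>.\<close>

lemma range_funpow_invariant:
  assumes "\<And>v. X (K v) = scale a (K (X v)) + scale b (K (K v))" and "v \<in> range (K ^^ n)"
  shows "X v \<in> range (K ^^ n)"
  using assms(2)
proof (induction n arbitrary: v)
  case (Suc n)
  then obtain u where u: "v = K ((K ^^ n) u)"
    by auto
  obtain w where "X ((K ^^ n) u) = (K ^^ n) w"
    using Suc.IH[of "(K ^^ n) u"] by auto
  then have "X v = (K ^^ Suc n) (scale a w + scale b (K u))"
    by (simp add: u assms(1) funpow_add_right funpow_scale_right K_add K_scale)
       (simp add: funpow_swap1)
  then show ?case
    by blast
qed simp

text \<open>The mirror image: here a factor \<open>K\<close> passes to the right of \<open>X\<close>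
  and reaches the vector. The induction hypothesis is applied to \<open>K v\<close>, which is killed
  by one power less.\<close>

lemma kernel_funpow_invariant:
  assumes "\<And>v. K (X v) = scale a (X (K v)) + scale b (K (K v))" and "X 0 = 0"
    and "(K ^^ n) v = 0"
  shows "(K ^^ n) (X v) = 0"
  using assms(3)
proof (induction n arbitrary: v)
  case 0
  then show ?case
    by (simp add: assms(2))
next
  case (Suc n)
  then have 0: "(K ^^ n) (K v) = 0"
    by (simp add: funpow_swap1)
  have "(K ^^ Suc n) (X v) = (K ^^ n) (K (X v))"
    by (simp add: funpow_swap1)
  also have "\<dots> = scale a ((K ^^ n) (X (K v))) + scale b (K ((K ^^ n) (K v)))"
    by (simp add: assms(1) funpow_add_right funpow_scale_right funpow_swap1)
  also have "\<dots> = 0"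
    using Suc.IH[OF 0] 0 funpow_0_right[of 1] by simp
  finally show ?case .
qed

end

end

section \<open>Stabilization of subspace chains and Fitting's lemma\<close>

context finite_dimensional_vector_space
begin

text \<open>Choose a member of least dimension: later members lie inside it and cannot be smaller in
  dimension, so they coincide with it.\<close>

lemma subspace_chain_decreasing_stable:
  assumes "\<And>n. subspace (A n)" "antimono A"
  obtains N :: nat where "\<And>n. n \<ge> N \<Longrightarrow> A n = A N"
proof -
  obtain N where "\<And>n. dim (A N) \<le> dim (A n)"
    using ex_has_least_nat[of "\<lambda>_. True" _ "\<lambda>n. dim (A n)"] by blast
  then have "A n = A N" if "n \<ge> N" for n
    using assms antimonoD[OF assms(2) that] by (intro subspace_dim_equal) auto
  then show thesis
    using that by blast
qed

lemma subspace_chain_increasing_stable: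
  assumes "\<And>n. subspace (A n)" "mono A"
  obtains N :: nat where "\<And>n. n \<ge> N \<Longrightarrow> A n = A N"
proof -
  obtain N where "\<And>n. dim (A n) \<le> dim (A N)"
    \<comment> \<open>The dimensions are at most \<open>dimension\<close>;
      \<open>Suc dimension\<close> serves as a strict bound, so a largest one exists.\<close>
    using ex_has_greatest_nat[of "\<lambda>_. True" _ "\<lambda>n. dim (A n)" "Suc dimension"] dim_subset_UNIV
    by (meson le_imp_less_Suc)
  then have "A N = A n" if "n \<ge> N" for n
    using assms monoD[OF assms(2) that] by (intro subspace_dim_equal) auto
  then show thesis
    using that by metis
qed

text \<open>Beyond some \<open>N\<close> both the ranges and the kernels of powers are constant,
  which turns the intersection and the union into one range and one kernel. Exposing
  \<open>N\<close> lets the invariance lemmas for a fixed power apply to both parts.\<close>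

lemma fitting_decomposition:
  assumes K_add: "\<And>v w. K (v + w) = K v + K w"
    and K_scale: "\<And>c v. K (scale c v) = scale c (K v)"
  obtains N where "invertible_part K = range (K ^^ N)" "nilpotent_part K = {v. (K ^^ N) v = 0}"
    "{u + w | u w. u \<in> invertible_part K \<and> w \<in> nilpotent_part K} = UNIV"
    "invertible_part K \<inter> nilpotent_part K = {0}"
    "bij_betw K (invertible_part K) (invertible_part K)"
proof -
  note K = K_add K_scale
  have anti: "antimono (\<lambda>n. range (K ^^ n))"
    by (rule decseq_SucI) (auto simp: funpow_swap1)
  have "mono (\<lambda>n. {v. (K ^^ n) v = 0})"
    using funpow_0_right[OF K, of 1] by (intro incseq_SucI) auto
  then obtain N1 where N1: "\<And>n. n \<ge> N1 \<Longrightarrow> {v. (K ^^ n) v = 0} = {v. (K ^^ N1) v = 0}"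
    by (rule subspace_chain_increasing_stable[OF subspace_kernel_funpow[OF K]]) (rule that)
  obtain N2 where N2: "\<And>n. n \<ge> N2 \<Longrightarrow> range (K ^^ n) = range (K ^^ N2)"
    by (rule subspace_chain_decreasing_stable[OF subspace_range_funpow[OF K] anti]) (rule that)
  define N where "N = max N1 N2"
  have ker: "{v. (K ^^ n) v = 0} = {v. (K ^^ N) v = 0}"
    and ran: "range (K ^^ n) = range (K ^^ N)" if "n \<ge> N" for n
    using that N1[of n] N1[of N] N2[of n] N2[of N] by (simp_all add: N_def)
  have inv: "invertible_part K = range (K ^^ N)"
  proof -
    have "range (K ^^ N) \<subseteq> range (K ^^ n)" for n
      using ran[of n] antimonoD[OF anti, of n N] by (cases "n \<ge> N") auto
    then show ?thesis
      unfolding invertible_part_def by blast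
  qed
  have nil: "nilpotent_part K = {v. (K ^^ N) v = 0}"
  proof -
    have "{v. (K ^^ n) v = 0} \<subseteq> {v. (K ^^ N) v = 0}" for n
      using ker[of n] monoD[OF \<open>mono _\<close>, of n N] by (cases "n \<ge> N") auto
    then show ?thesis
      unfolding nilpotent_part_def by blast
  qed
  \<comment> \<open>If \<open>v = (K ^^ N) w\<close> is killed by \<open>K ^^ N\<close>, then
    \<open>w\<close> lies in the kernel of the power \<open>N + N\<close>, which equals that of
    \<open>N\<close>; so \<open>v = 0\<close>.\<close>
  have int: "v = 0" if v: "v \<in> invertible_part K" "v \<in> nilpotent_part K" for v
  proof -
    obtain w where w: "v = (K ^^ N) w"
      using v inv by blast
    then have "(K ^^ (N + N)) w = 0"
      using v nil by (simp add: funpow_add)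
    then show ?thesis
      using ker[of "N + N"] w by auto
  qed
  \<comment> \<open>Stability of ranges writes \<open>(K ^^ N) v\<close> as
    \<open>(K ^^ (N + N)) w\<close>; subtracting \<open>(K ^^ N) w\<close> from \<open>v\<close>
    leaves a nilpotent vector.\<close>
  have sum: "\<exists>u\<in>invertible_part K. \<exists>w\<in>nilpotent_part K. v = u + w" for v
  proof -
    obtain w where w: "(K ^^ N) v = (K ^^ (N + N)) w"
      using ran[of "N + N"] by (metis le_add1 rangeE rangeI)
    then have "v - (K ^^ N) w \<in> nilpotent_part K"
      by (simp add: nil funpow_diff_right[OF K] funpow_add)
    moreover have "(K ^^ N) w \<in> invertible_part K"
      by (simp add: inv)
    ultimately show ?thesis
      by (metis add.commute diff_add_cancel)
  qed
  have surj: "K ` invertible_part K = invertible_part K"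
    unfolding inv using ran[of "Suc N"] by (simp add: image_comp)
  have sub: "subspace (invertible_part K)"
    unfolding inv by (rule subspace_range_funpow[OF K])
  \<comment> \<open>The kernel of \<open>K\<close> is contained in the nilpotent part, which meets
    the invertible part only in \<open>0\<close>.\<close>
  have inj: "inj_on K (invertible_part K)"
  proof (rule inj_onI)
    fix v w assume v: "v \<in> invertible_part K" "w \<in> invertible_part K" "K v = K w"
    then have "(K ^^ 1) (v - w) = 0"
      using funpow_diff_right[OF K, of 1] by simp
    then have "v - w \<in> nilpotent_part K"
      unfolding nilpotent_part_def by blast
    then show "v = w"
      using int[of "v - w"] subspace_diff[OF sub] v by simp
  qed
  show thesis
  proof (rule that[OF inv nil])
    show "{u + w | u w. u \<in> invertible_part K \<and> w \<in> nilpotent_part K} = UNIV"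
      using sum by blast
    show "invertible_part K \<inter> nilpotent_part K = {0}"
      using int subspace_0[OF sub] funpow_0_right[OF K, of N] nil by auto
    show "bij_betw K (invertible_part K) (invertible_part K)"
      using inj surj by (simp add: bij_betw_def)
  qed
qed

end

text \<open>Injectivity would let the factors of \<open>T\<close> be stripped one by one from
  \<open>(T ^^ n) v = 0\<close>, forcing \<open>v = 0\<close>. As injectivity is assumed on this
  part only, each stage uses that \<open>T\<close> maps the part into itself.\<close>

lemma not_inj_on_nilpotent_part:
  fixes T :: "'v::zero \<Rightarrow> 'v"
  assumes "nilpotent_part T \<noteq> {0}" and T0: "T 0 = 0"
  shows "\<not> inj_on T (nilpotent_part T)"
proof
  assume inj: "inj_on T (nilpotent_part T)"
  have closed: "0 \<in> nilpotent_part T" "T v \<in> nilpotent_part T" if v: "v \<in> nilpotent_part T" for v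
  proof -
    show "0 \<in> nilpotent_part T"
      unfolding nilpotent_part_def by (auto intro: exI[of _ 0])
    obtain n where "(T ^^ n) v = 0"
      using v by (auto simp: nilpotent_part_def)
    then have "(T ^^ n) (T v) = 0"
      by (simp add: T0 flip: funpow_swap1)
    then show "T v \<in> nilpotent_part T"
      by (auto simp: nilpotent_part_def)
  qed
  have "v = 0" if "(T ^^ n) v = 0" "v \<in> nilpotent_part T" for v n
    using that
  proof (induction n arbitrary: v)
    case (Suc n)
    then have "T v = 0"
      using closed(2)[of v] by (simp add: funpow_swap1)
    then show ?case
      using inj_onD[OF inj, of v 0] Suc.prems closed T0 by simp
  qed simp
  then have "nilpotent_part T \<subseteq> {0}"
    unfolding nilpotent_part_def by blast
  moreover have "0 \<in> nilpotent_part T"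
    unfolding nilpotent_part_def by (auto intro: exI[of _ 0])
  ultimately show False
    using assms(1) by blast
qed

section \<open>Decomposition into submodules and the two extension claims\<close>

theorem lemma11p9:
  fixes q :: "'a::field"
    and scale :: "'a \<Rightarrow> 'v::ab_group_add \<Rightarrow> 'v"
    and B :: "'v set"
    and \<rho> :: "('a, uq_gen) free_alg set \<Rightarrow> 'v \<Rightarrow> 'v"
  assumes "q \<noteq> 0" and "q ^ 4 \<noteq> 1"
    and "finite_dimensional_vector_space scale B"
    and "vector_space.dim scale (UNIV :: 'v set) > 0"
    and "Uq_vee_action q scale UNIV \<rho>"
  defines "V_inv \<equiv> invertible_part (\<rho> (uq_yinv q))"
    and "V_nil \<equiv> nilpotent_part (\<rho> (uq_yinv q))"
  shows "module_direct_sum q scale \<rho> V_inv V_nil \<and>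
    (V_inv \<noteq> {0} \<longrightarrow> extends_to_Uq q scale V_inv \<rho>) \<and>
    (V_nil \<noteq> {0} \<longrightarrow> \<not> extends_to_Uq q scale V_nil \<rho>)"
proof -
  interpret V: finite_dimensional_vector_space scale B
    by fact
  note act = assms(5)[unfolded Uq_vee_action_def]
  \<comment> \<open>A vanishing difference would give \<open>q * q = 1\<close> and hence
    \<open>q ^ 4 = 1\<close>.\<close>
  have q: "q - inverse q \<noteq> 0"
  proof
    assume "q - inverse q = 0"
    then have "q * q = 1"
      using \<open>q \<noteq> 0\<close> by (metis eq_iff_diff_eq_0 right_inverse)
    then have "q ^ 4 = 1"
      by (simp add: power4_eq_xxxx)
    then show False
      using assms(2) by simp
  qed
  define K where "K = \<rho> (uq_yinv q)"
  define X where "X = \<rho> (uq_x q)"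
  define Z where "Z = \<rho> (uq_z q)"
  have gens: "uq_x q \<in> carrier (Uq_vee q)" "uq_yinv q \<in> carrier (Uq_vee q)" "uq_z q \<in> carrier (Uq_vee q)"
    by (simp_all add: uq_x_def uq_yinv_def uq_z_def)
  have K: "K (v + w) = K v + K w" "K (scale c v) = scale c (K v)" for v w c
    using alg_action_add_right[OF act] alg_action_scale_right[OF act] gens by (simp_all add: K_def)
  have at_0: "X 0 = 0" "K 0 = 0" "Z 0 = 0"
    using alg_action_scale_right[OF act, of _ 0 0] gens by (simp_all add: X_def K_def Z_def)
  have KX: "scale q (K (X v)) - scale (inverse q) (X (K v)) = scale (q - inverse q) (K (K v))"
    and ZK: "scale q (Z (K v)) - scale (inverse q) (K (Z v)) = scale (q - inverse q) (K (K v))" for v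
    unfolding X_def K_def Z_def
    by (fact V.vee_act_yinv_x[OF assms(5) q UNIV_I] V.vee_act_z_yinv[OF assms(5) q UNIV_I])+
  \<comment> \<open>Both coefficients \<open>q\<close> and \<open>inverse q\<close> are invertible,
    so the relation can be solved for either product; this yields rules for moving \<open>K\<close>
    past an operator in both directions.\<close>
  have solve: "w = scale (inverse q * inverse q) u + scale (inverse q * (q - inverse q)) t"
    "u = scale (q * q) w + scale (- (q * (q - inverse q))) t"
    if eq: "scale q w - scale (inverse q) u = scale (q - inverse q) t" for u w t
  proof -
    have "w = scale (inverse q) (scale q w)"
      using \<open>q \<noteq> 0\<close> by simp
    also have "scale q w = scale (inverse q) u + scale (q - inverse q) t"
      by (simp flip: eq)
    finally show "w = scale (inverse q * inverse q) u + scale (inverse q * (q - inverse q)) t"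
      by (simp only: V.scale_right_distrib V.scale_scale)
    have "u = scale q (scale (inverse q) u)"
      using \<open>q \<noteq> 0\<close> by simp
    also have "scale (inverse q) u = scale q w - scale (q - inverse q) t"
      by (simp flip: eq)
    finally show "u = scale (q * q) w + scale (- (q * (q - inverse q))) t"
      by (simp add: V.scale_right_diff_distrib)
  qed
  \<comment> \<open>\<open>KX(2)\<close> and \<open>ZK(1)\<close> move \<open>K\<close> to the left,
    as invariance of ranges requires; \<open>KX(1)\<close> and \<open>ZK(2)\<close> move it to the
    right, for kernels. The indices differ because the two relations order their products
    oppositely.\<close>
  note KX = solve[OF KX] and ZK = solve[OF ZK]
  have parts: "V_inv = invertible_part K" "V_nil = nilpotent_part K"
    by (simp_all add: V_inv_def V_nil_def K_def)
  obtain N where inv: "V_inv = range (K ^^ N)" and nil: "V_nil = {v. (K ^^ N) v = 0}"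
    and dec: "{u + w | u w. u \<in> V_inv \<and> w \<in> V_nil} = UNIV" "V_inv \<inter> V_nil = {0}"
    and bij: "bij_betw K V_inv V_inv"
    by (rule V.fitting_decomposition[OF K, folded parts]) (rule that)
  have sub_inv: "Uq_vee_submodule q scale \<rho> V_inv"
    unfolding inv
  proof (rule V.Uq_vee_submoduleI[OF assms(5) V.subspace_range_funpow[OF K]])
    fix v assume v: "v \<in> range (K ^^ N)"
    show "\<rho> (uq_x q) v \<in> range (K ^^ N)"
      using V.range_funpow_invariant[OF K KX(2) v] by (simp add: X_def)
    show "\<rho> (uq_yinv q) v \<in> range (K ^^ N)"
      using bij v by (simp add: bij_betw_def inv flip: K_def) blast
    show "\<rho> (uq_z q) v \<in> range (K ^^ N)"
      using V.range_funpow_invariant[OF K ZK(1) v] by (simp add: Z_def)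
  qed
  have sub_nil: "Uq_vee_submodule q scale \<rho> V_nil"
    unfolding nil
  proof (rule V.Uq_vee_submoduleI[OF assms(5) V.subspace_kernel_funpow[OF K]]; unfold mem_Collect_eq)
    fix v assume v: "(K ^^ N) v = 0"
    show "(K ^^ N) (\<rho> (uq_x q) v) = 0"
      using V.kernel_funpow_invariant[OF K KX(1) at_0(1) v] by (simp add: X_def)
    show "(K ^^ N) (\<rho> (uq_yinv q) v) = 0"
      using v at_0(2) by (simp flip: K_def funpow_swap1)
    show "(K ^^ N) (\<rho> (uq_z q) v) = 0"
      using V.kernel_funpow_invariant[OF K ZK(2) at_0(3) v] by (simp add: Z_def)
  qed
  have "extends_to_Uq q scale V_inv \<rho>"
    using V.extends_to_UqI[OF V.Uq_vee_action_submodule[OF assms(5) sub_inv] q] bij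
    by (simp add: K_def)
  \<comment> \<open>An extension would make \<open>K\<close> injective on a nonzero nilpotent
    part.\<close>
  moreover have "\<not> extends_to_Uq q scale V_nil \<rho>" if "V_nil \<noteq> {0}"
    using V.extends_to_Uq_imp_inj_on[of q V_nil \<rho>] not_inj_on_nilpotent_part[of K] that at_0(2)
    by (auto simp: parts simp flip: K_def)
  ultimately show ?thesis
    unfolding module_direct_sum_def using sub_inv sub_nil dec by blast
qed

end
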